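(* Any (possibly randomized) $(1+\epsilon)$-approximation algorithm for the minimum spanning tree problem has Lipschitz constant $\Omega(\epsilon^{-1})$; that is, there is an input graph on which its Lipschitz constant is at least $c/\epsilon$ for an absolute constant $c>0$.
   Context: Minimum spanning tree problem: given a connected undirected graph $G=(V,E)$ (parallel edges allowed) and $w\in\mathbb{R}_{\geq0}^E$, output a spanning tree $T$ minimizing $\sum_{e\in T}w(e)$. A randomized algorithm is a $(1+\epsilon)$-approximation if the expected weight of its output is at most $(1+\epsilon)$ times the optimum. For edge sets $F,F'$, $d_w((F,w),(F',w'))=\|\sum_{e\in F}w(e)\mathbf{1}_e-\sum_{e\in F'}w'(e)\mathbf{1}_e\|_1$; $\mathrm{EM}_\mathrm{w}$ of two output distributions is the minimum over couplings of the expected $d_w$; the Lipschitz constant of $\mathcal{A}$ on $G$ is $\sup_{w\neq w'}\mathrm{EM}_\mathrm{w}((\mathcal{A}(G,w),w),(\mathcal{A}(G,w'),w'))/\|w-w'\|_1$. *)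

theory Defs
  imports "HOL-Probability.Probability"
begin

text \<open>Undirected multigraphs: every edge has a name, and \<open>ends\<close> assigns to it its
  two-element set of endpoints, so parallel edges are allowed and self-loops are not.\<close>

record ('v, 'e) multigraph =
  verts :: "'v set"
  edges :: "'e set"
  ends :: "'e \<Rightarrow> 'v set"

definition multigraph :: "('v, 'e) multigraph \<Rightarrow> bool" where
  "multigraph G \<longleftrightarrow> finite (verts G) \<and> finite (edges G) \<and>
     ends G \<in> edges G \<rightarrow>\<^sub>E {s. s \<subseteq> verts G \<and> card s = 2}"

definition edge_rel :: "('v, 'e) multigraph \<Rightarrow> 'e set \<Rightarrow> 'v rel" where
  "edge_rel G F = {(u, v). \<exists>e\<in>F. ends G e = {u, v}}"

text \<open>The spanning subgraph with edge set \<open>F\<close> is connected.\<close>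

definition connects :: "('v, 'e) multigraph \<Rightarrow> 'e set \<Rightarrow> bool" where
  "connects G F \<longleftrightarrow> verts G \<noteq> {} \<and> (\<forall>u\<in>verts G. \<forall>v\<in>verts G. (u, v) \<in> (edge_rel G F)\<^sup>*)"

definition connected_multigraph :: "('v, 'e) multigraph \<Rightarrow> bool" where
  "connected_multigraph G \<longleftrightarrow> multigraph G \<and> connects G (edges G)"

text \<open>A cycle visits distinct vertices \<open>vs\<close> along distinct edges \<open>es\<close>; a pair of parallel
  edges forms a cycle of length two.\<close>

definition is_cycle :: "('v, 'e) multigraph \<Rightarrow> 'v list \<Rightarrow> 'e list \<Rightarrow> bool" where
  "is_cycle G vs es \<longleftrightarrow> length vs = length es \<and> 2 \<le> length es \<and> distinct vs \<and> distinct es \<and>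
     (\<forall>i<length es. ends G (es ! i) = {vs ! i, vs ! (Suc i mod length vs)})"

definition acyclic_edges :: "('v, 'e) multigraph \<Rightarrow> 'e set \<Rightarrow> bool" where
  "acyclic_edges G F \<longleftrightarrow> \<not> (\<exists>vs es. set es \<subseteq> F \<and> is_cycle G vs es)"

definition spanning_tree :: "('v, 'e) multigraph \<Rightarrow> 'e set \<Rightarrow> bool" where
  "spanning_tree G T \<longleftrightarrow> T \<subseteq> edges G \<and> connects G T \<and> acyclic_edges G T"

text \<open>Weight vectors live in the nonnegative orthant over the edge set. Requiring them to be
  extensional makes them determined by their values on the edges, so distinct weight vectors have
  positive \<open>\<ell>\<^sub>1\<close> distance.\<close>

definition weights :: "('v, 'e) multigraph \<Rightarrow> ('e \<Rightarrow> real) set" where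
  "weights G = edges G \<rightarrow>\<^sub>E {0..}"

definition mst_weight :: "('v, 'e) multigraph \<Rightarrow> ('e \<Rightarrow> real) \<Rightarrow> real" where
  "mst_weight G w = Min ((\<lambda>T. \<Sum>e\<in>T. w e) ` {T. spanning_tree G T})"

text \<open>A randomized algorithm maps each input to a distribution over edge sets. A discrete
  distribution is fully general, since the set of spanning trees is finite.\<close>

type_synonym ('v, 'e) rand_alg = "('v, 'e) multigraph \<Rightarrow> ('e \<Rightarrow> real) \<Rightarrow> 'e set pmf"

definition mst_approx :: "real \<Rightarrow> ('v, 'e) rand_alg \<Rightarrow> bool" where
  "mst_approx \<epsilon> A \<longleftrightarrow> (\<forall>G w. connected_multigraph G \<longrightarrow> w \<in> weights G \<longrightarrow>
     (\<forall>T\<in>set_pmf (A G w). spanning_tree G T) \<and>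
     measure_pmf.expectation (A G w) (\<lambda>T. \<Sum>e\<in>T. w e) \<le> (1 + \<epsilon>) * mst_weight G w)"

definition l1_norm_on :: "'e set \<Rightarrow> ('e \<Rightarrow> real) \<Rightarrow> real" where
  "l1_norm_on E x = (\<Sum>e\<in>E. \<bar>x e\<bar>)"

definition weighted_dist ::
    "('v, 'e) multigraph \<Rightarrow> 'e set \<times> ('e \<Rightarrow> real) \<Rightarrow> 'e set \<times> ('e \<Rightarrow> real) \<Rightarrow> real" where
  "weighted_dist G = (\<lambda>(F, w) (F', w'). l1_norm_on (edges G)
     (\<lambda>i. (\<Sum>e\<in>F. w e * indicator {e} i) - (\<Sum>e\<in>F'. w' e * indicator {e} i)))"

definition couplings :: "'a pmf \<Rightarrow> 'b pmf \<Rightarrow> ('a \<times> 'b) pmf set" where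
  "couplings p q = {\<pi>. map_pmf fst \<pi> = p \<and> map_pmf snd \<pi> = q}"

definition EMw ::
    "('v, 'e) multigraph \<Rightarrow> 'e set pmf \<times> ('e \<Rightarrow> real) \<Rightarrow> 'e set pmf \<times> ('e \<Rightarrow> real) \<Rightarrow> ennreal" where
  "EMw G = (\<lambda>(p, w) (q, w').
     INF \<pi>\<in>couplings p q. \<integral>\<^sup>+ (F, F'). ennreal (weighted_dist G (F, w) (F', w')) \<partial>measure_pmf \<pi>)"

definition lipschitz_const :: "('v, 'e) rand_alg \<Rightarrow> ('v, 'e) multigraph \<Rightarrow> ennreal" where
  "lipschitz_const A G = (SUP (w, w') \<in> {(w, w'). w \<in> weights G \<and> w' \<in> weights G \<and> w \<noteq> w'}.
     EMw G (A G w, w) (A G w', w') / ennreal (l1_norm_on (edges G) (\<lambda>e. w e - w' e)))"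

end

theory Submission
  imports Defs
begin

text \<open>Take two vertices joined by two parallel edges. Making one edge cost \<open>1\<close> and the other
  \<open>1 + 4\<epsilon>\<close> forces the algorithm to output the cheap edge with probability at least \<open>3/4\<close>.
  Swapping the two costs moves the weight vector by only \<open>8\<epsilon>\<close>, while under any coupling the two
  outputs are the respective cheap edges with probability at least \<open>1/2\<close>, at distance \<open>2\<close>; hence
  the Lipschitz constant is at least \<open>1/(8\<epsilon>)\<close>.\<close>

definition parallel_pair :: "(nat, nat) multigraph" where
  "parallel_pair = \<lparr>verts = {0, 1}, edges = {0, 1}, ends = (\<lambda>e\<in>{0, 1}. {0, 1})\<rparr>"

lemma parallel_pair_simps [simp]:
  "verts parallel_pair = {0, 1}"
  "edges parallel_pair = {0, 1}"
  "e \<in> {0, 1} \<Longrightarrow> ends parallel_pair e = {0, 1}"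
  by (auto simp: parallel_pair_def)

lemma multigraph_parallel_pair: "multigraph parallel_pair"
  by (auto simp: multigraph_def parallel_pair_def)

lemma connects_parallel_pair:
  assumes "F \<inter> {0, 1} \<noteq> {}"
  shows "connects parallel_pair F"
proof -
  from assms obtain e where e: "e \<in> F" "e \<in> {0, 1}" by blast
  from e(2) have "ends parallel_pair e = {0, 1}"
    by (rule parallel_pair_simps(3))
  with e have "\<exists>e\<in>F. ends parallel_pair e = {0, 1}"
    by (intro bexI[of _ e])
  then have edge: "(0, 1) \<in> edge_rel parallel_pair F" "(1, 0) \<in> edge_rel parallel_pair F"
    unfolding edge_rel_def mem_Collect_eq prod.case insert_commute[of 1 0] by assumption+
  have "(u, v) \<in> (edge_rel parallel_pair F)\<^sup>*" if "u \<in> {0, 1}" "v \<in> {0, 1}" for u v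
    using that edge[THEN r_into_rtrancl] by (elim insertE emptyE) simp_all
  then show ?thesis
    unfolding connects_def parallel_pair_simps by blast
qed

lemma connected_parallel_pair: "connected_multigraph parallel_pair"
  by (simp add: connected_multigraph_def multigraph_parallel_pair connects_parallel_pair)

text \<open>A cycle uses at least two distinct edges.\<close>

lemma acyclic_edges_singleton: "acyclic_edges G {e}"
proof -
  have False if "set es \<subseteq> {e}" "is_cycle G vs es" for vs es
  proof -
    have "length es = card (set es)"
      using that(2) by (simp add: is_cycle_def distinct_card)
    also have "\<dots> \<le> 1"
      using card_mono[OF _ that(1)] by simp
    finally show False
      using that(2) by (simp add: is_cycle_def)
  qed
  then show ?thesis
    unfolding acyclic_edges_def by blast
qed

text \<open>Either edge alone connects the two vertices, and both together form a cycle of length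
  two.\<close>

lemma spanning_tree_parallel_pair:
  "spanning_tree parallel_pair T \<longleftrightarrow> T = {0} \<or> T = {1}"
proof
  assume T: "spanning_tree parallel_pair T"
  have "T \<noteq> {}"
    using T by (auto simp: spanning_tree_def connects_def edge_rel_def)
  moreover have "T \<noteq> {0, 1}"
  proof
    assume "T = {0, 1}"
    moreover have "is_cycle parallel_pair [0, 1] [0, 1]"
      by (auto simp: is_cycle_def less_Suc_eq)
    ultimately show False
      using T unfolding spanning_tree_def acyclic_edges_def
      by (metis empty_set list.simps(15) order_refl)
  qed
  moreover have "T \<in> Pow {0, 1}"
    using T by (auto simp: spanning_tree_def)
  then have "T \<in> {{}, {0}, {1}, {0, 1}}"
    by (auto simp: Pow_insert)
  ultimately show "T = {0} \<or> T = {1}"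
    by blast
next
  assume "T = {0} \<or> T = {1}"
  then show "spanning_tree parallel_pair T"
    by (auto simp: spanning_tree_def connects_parallel_pair acyclic_edges_singleton)
qed

text \<open>The restriction to the edge set gives the extensionality that \<open>weights\<close>
  demands. With cheap cost \<open>1\<close>, the optimum is \<open>1\<close>, so relative and
  absolute error coincide.\<close>

definition cheap_edge_weight :: "real \<Rightarrow> nat \<Rightarrow> nat \<Rightarrow> real" where
  "cheap_edge_weight \<delta> a = (\<lambda>e\<in>{0, 1}. if e = a then 1 else 1 + \<delta>)"

lemma cheap_edge_weight_in_weights:
  "\<delta> \<ge> 0 \<Longrightarrow> cheap_edge_weight \<delta> a \<in> weights parallel_pair"
  by (auto simp: weights_def cheap_edge_weight_def)

lemma mst_weight_parallel_pair:
  assumes "\<delta> \<ge> 0" "a \<in> {0, 1}"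
  shows "mst_weight parallel_pair (cheap_edge_weight \<delta> a) = 1"
proof -
  have "{T. spanning_tree parallel_pair T} = {{0}, {1}}"
    by (auto simp: spanning_tree_parallel_pair)
  then show ?thesis
    using assms by (auto simp: mst_weight_def cheap_edge_weight_def)
qed

text \<open>A Markov-type argument: missing the cheap edge costs an excess of
  \<open>k * \<epsilon>\<close>, while the expected excess is at most
  \<open>\<epsilon>\<close>.\<close>

lemma prob_cheap_edge:
  assumes A: "mst_approx \<epsilon> A" and "\<epsilon> > 0" "k > 0" "a \<in> {0, 1}"
  shows "measure_pmf.prob (A parallel_pair (cheap_edge_weight (k * \<epsilon>) a)) {{a}} \<ge> 1 - 1 / k"
proof -
  let ?w = "cheap_edge_weight (k * \<epsilon>) a"
  let ?p = "A parallel_pair ?w"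
  have nonneg: "k * \<epsilon> \<ge> 0" using assms by simp
  have tree: "T = {0} \<or> T = {1}" if "T \<in> set_pmf ?p" for T
    using A that connected_parallel_pair cheap_edge_weight_in_weights[OF nonneg]
    unfolding mst_approx_def spanning_tree_parallel_pair[symmetric] by blast
  have approx: "measure_pmf.expectation ?p (\<lambda>T. \<Sum>e\<in>T. ?w e) \<le> (1 + \<epsilon>) * mst_weight parallel_pair ?w"
    using A connected_parallel_pair cheap_edge_weight_in_weights[OF nonneg]
    unfolding mst_approx_def by blast
  \<comment> \<open>Only two outputs are possible, so on the support the cost is affine in the
    indicator of \<open>{a}\<close> and its expectation is affine in the probability sought.\<close>
  have "(\<Sum>e\<in>T. ?w e) = 1 + k * \<epsilon> - k * \<epsilon> * indicator {{a}} T" if "T \<in> set_pmf ?p" for T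
    using tree[OF that] assms(4) by (auto simp: cheap_edge_weight_def)
  then have "measure_pmf.expectation ?p (\<lambda>T. \<Sum>e\<in>T. ?w e) =
      measure_pmf.expectation ?p (\<lambda>T. 1 + k * \<epsilon> - k * \<epsilon> * indicator {{a}} T)"
    by (intro integral_cong_AE) (auto simp: AE_measure_pmf_iff)
  also have "\<dots> = 1 + k * \<epsilon> - k * \<epsilon> * measure_pmf.prob ?p {{a}}"
    by (subst Bochner_Integration.integral_diff)
      (auto intro!: measure_pmf.integrable_const_bound[where B = 1])
  finally have "1 + k * \<epsilon> - k * \<epsilon> * measure_pmf.prob ?p {{a}} \<le> 1 + \<epsilon>"
    using approx mst_weight_parallel_pair[OF nonneg assms(4)] by simp
  then have "\<epsilon> * (k * (1 - measure_pmf.prob ?p {{a}})) \<le> \<epsilon> * 1"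
    by (simp add: algebra_simps)
  then have "k * (1 - measure_pmf.prob ?p {{a}}) \<le> 1"
    using \<open>\<epsilon> > 0\<close> by (simp only: mult_le_cancel_left_pos)
  then show ?thesis
    using \<open>k > 0\<close> by (simp add: field_simps)
qed

text \<open>Inclusion-exclusion for the two marginal events, whose union has probability at most
  \<open>1\<close>.\<close>

lemma coupling_prob_ge:
  assumes "\<pi> \<in> couplings p q"
  shows "measure_pmf.prob \<pi> {(x, y)} \<ge> measure_pmf.prob p {x} + measure_pmf.prob q {y} - 1"
proof -
  let ?X = "fst -` {x}" and ?Y = "snd -` {y}"
  have p: "measure_pmf.prob p {x} = measure_pmf.prob \<pi> ?X"
    and q: "measure_pmf.prob q {y} = measure_pmf.prob \<pi> ?Y"
    using assms by (auto simp: couplings_def)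
  have "{(x, y)} = ?X \<inter> ?Y"
    by auto
  moreover have "measure_pmf.prob \<pi> (?X \<union> ?Y) =
      measure_pmf.prob \<pi> ?X + measure_pmf.prob \<pi> ?Y - measure_pmf.prob \<pi> (?X \<inter> ?Y)"
    by (rule measure_Un3) (auto simp: fmeasurable_def less_top[symmetric])
  moreover have "measure_pmf.prob \<pi> (?X \<union> ?Y) \<le> 1"
    by simp
  ultimately show ?thesis
    unfolding p q by simp
qed

lemma EMw_ge_atom:
  assumes "weighted_dist G (F, w) (F', w') \<ge> d" "d \<ge> 0"
    and "measure_pmf.prob p {F} + measure_pmf.prob q {F'} - 1 \<ge> r"
  shows "EMw G (p, w) (q, w') \<ge> ennreal (d * r)"
  unfolding EMw_def prod.case
proof (rule INF_greatest)
  fix \<pi> assume \<pi>: "\<pi> \<in> couplings p q"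
  have "d * r \<le> d * measure_pmf.prob \<pi> {(F, F')}"
    using coupling_prob_ge[OF \<pi>, of F F'] assms by (intro mult_left_mono) auto
  then have "ennreal (d * r) \<le> ennreal d * emeasure \<pi> {(F, F')}"
    using assms(2) by (simp add: measure_pmf.emeasure_eq_measure ennreal_mult'[symmetric] ennreal_leI)
  also have "\<dots> = (\<integral>\<^sup>+ x. ennreal d * indicator {(F, F')} x \<partial>measure_pmf \<pi>)"
    by simp
  also have "\<dots> \<le> (\<integral>\<^sup>+ (T, T'). ennreal (weighted_dist G (T, w) (T', w')) \<partial>measure_pmf \<pi>)"
    using assms(1) by (intro nn_integral_mono) (auto simp: indicator_def ennreal_leI)
  finally show "ennreal (d * r) \<le>
      (\<integral>\<^sup>+ (T, T'). ennreal (weighted_dist G (T, w) (T', w')) \<partial>measure_pmf \<pi>)" .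
qed

lemma lipschitz_const_ge:
  assumes "w \<in> weights G" "w' \<in> weights G" "w \<noteq> w'"
  shows "lipschitz_const A G \<ge>
    EMw G (A G w, w) (A G w', w') / ennreal (l1_norm_on (edges G) (\<lambda>e. w e - w' e))"
  unfolding lipschitz_const_def using assms by (intro SUP_upper2[of "(w, w')"]) auto

theorem theorem6p1:
  shows "\<exists>c::real. c > 0 \<and>
    (\<forall>\<epsilon>::real. \<epsilon> > 0 \<longrightarrow>
      (\<forall>A :: (nat, nat) rand_alg. mst_approx \<epsilon> A \<longrightarrow>
        (\<exists>G. connected_multigraph G \<and> lipschitz_const A G \<ge> ennreal (c / \<epsilon>))))"
proof (intro exI[of _ "1/8"] conjI allI impI)
  fix \<epsilon> :: real and A :: "(nat, nat) rand_alg"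
  assume \<epsilon>: "\<epsilon> > 0" and A: "mst_approx \<epsilon> A"
  \<comment> \<open>A gap of \<open>k * \<epsilon>\<close> would give the bound
    \<open>2 * (1 - 2/k) / (2 * k * \<epsilon>)\<close>; \<open>k = 4\<close> maximises it and
    yields \<open>1/8\<close>.\<close>
  let ?G = parallel_pair and ?w = "cheap_edge_weight (4 * \<epsilon>)"
  \<comment> \<open>The outputs are disjoint, so their costs of \<open>1\<close> add up instead of
    cancelling.\<close>
  have "weighted_dist ?G ({0}, ?w 0) ({1}, ?w 1) \<ge> 2"
    by (simp add: weighted_dist_def l1_norm_on_def cheap_edge_weight_def)
  moreover have "measure_pmf.prob (A ?G (?w 0)) {{0}} + measure_pmf.prob (A ?G (?w 1)) {{1}} - 1 \<ge> 1/2"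
    using prob_cheap_edge[OF A \<epsilon>, of 4 0] prob_cheap_edge[OF A \<epsilon>, of 4 1] by simp
  ultimately have EM: "EMw ?G (A ?G (?w 0), ?w 0) (A ?G (?w 1), ?w 1) \<ge> ennreal (2 * (1/2))"
    by (intro EMw_ge_atom) auto
  have l1: "l1_norm_on (edges ?G) (\<lambda>e. ?w 0 e - ?w 1 e) = 8 * \<epsilon>"
    using \<epsilon> by (simp add: l1_norm_on_def cheap_edge_weight_def)
  have "?w 0 \<noteq> ?w 1"
  proof
    assume "?w 0 = ?w 1"
    with l1 \<epsilon> show False
      by (simp add: l1_norm_on_def)
  qed
  have "ennreal (1 / 8 / \<epsilon>) = ennreal (2 * (1/2)) / ennreal (8 * \<epsilon>)"
    \<comment> \<open>Rewriting \<open>ennreal 1\<close> to \<open>1\<close> would keep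
      \<open>divide_ennreal\<close> from matching.\<close>
    using \<epsilon> by (simp add: divide_ennreal del: ennreal_1)
  also have "\<dots> \<le> EMw ?G (A ?G (?w 0), ?w 0) (A ?G (?w 1), ?w 1) / ennreal (8 * \<epsilon>)"
    using EM by (rule divide_right_mono_ennreal)
  also have "\<dots> \<le> lipschitz_const A ?G"
    unfolding l1[symmetric] using \<epsilon> \<open>?w 0 \<noteq> ?w 1\<close>
    by (intro lipschitz_const_ge cheap_edge_weight_in_weights) auto
  finally show "\<exists>G. connected_multigraph G \<and> lipschitz_const A G \<ge> ennreal (1 / 8 / \<epsilon>)"
    using connected_parallel_pair by blast
qed simp

end
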